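(* Let $(X,A,B,p,k,q,s)$ be a semi-biproduct of monoids. For every $b,b'\in B$ and $x\in X$ put $$b\cdot x=q(s(b)+k(x)),\qquad x^b=q(k(x)+s(b)),\qquad b\times b'=q(s(b)+s(b')),$$ all of which are elements of $X$. Then: (1) For every $a,a'\in A$, $$a+a'=k\bigl(q(a)+p(a)\cdot q(a')+(p(a)\times p(a'))\bigr)+sp(a+a')$$ and $$a+a'=k(u^v)+s(v),$$ where $u=q(a)+p(a)\cdot q(a')+(p(a)\times p(a'))\in X$ and $v=p(a+a')\in B$. (2) The map $\beta\colon A\to X\times B$, $\beta(a)=(q(a),p(a))$, is injective. An element $(y,b)\in X\times B$ is in the image of $\beta$ if and only if $y=x^b$ for some $x\in X$. Thus $\beta$ gives a bijection of $A$ with the set $\{(x^b,b)\mid (x,b)\in X\times B\}$, whose inverse is the map $\alpha$ given by $\alpha(x^b,b)=k(x^b)+s(b)=k(x)+s(b)$. (3) For every $a\in A$, $q(a)=q(a)^{p(a)}$.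
   Context: A map between monoids is zero-preserving if it sends the neutral element to the neutral element (it need not preserve the operation). A semi-biproduct of monoids $(X,A,B,p,k,q,s)$ consists of monoids $X,A,B$, monoid homomorphisms $k\colon X\to A$ and $p\colon A\to B$, and zero-preserving maps $q\colon A\to X$ and $s\colon B\to A$ such that $$ps=1_B,\quad qk=1_X,\quad kq+sp=1_A,\quad pk=0_{X,B},\quad qs=0_{B,X},$$ where $0$ denotes the constant map at the neutral element and $kq+sp$ is the pointwise sum, i.e. $k(q(a))+s(p(a))=a$ for all $a\in A$. The monoids $X$ and $A$ are written additively and $B$ multiplicatively (neutral element $1$); none is assumed commutative. *)

theory Defs
  imports "HOL-Algebra.Group"
begin

text \<open>
  All three monoids are written multiplicatively, as in HOL-Algebra; the sum in \<open>X\<close> and \<open>A\<close>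
  is \<open>\<otimes>\<^bsub>X\<^esub>\<close>, \<open>\<otimes>\<^bsub>A\<^esub>\<close>, and their zero is \<open>\<one>\<^bsub>X\<^esub>\<close>, \<open>\<one>\<^bsub>A\<^esub>\<close>.
\<close>

definition zero_preserving ::
    "('a, 'm) monoid_scheme \<Rightarrow> ('b, 'n) monoid_scheme \<Rightarrow> ('a \<Rightarrow> 'b) \<Rightarrow> bool" where
  "zero_preserving G H f \<longleftrightarrow> f \<in> carrier G \<rightarrow> carrier H \<and> f \<one>\<^bsub>G\<^esub> = \<one>\<^bsub>H\<^esub>"

text \<open>The set \<open>hom G H\<close> alone does not require the neutral element to be preserved.\<close>

definition monoid_homomorphism ::
    "('a, 'm) monoid_scheme \<Rightarrow> ('b, 'n) monoid_scheme \<Rightarrow> ('a \<Rightarrow> 'b) \<Rightarrow> bool" where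
  "monoid_homomorphism G H f \<longleftrightarrow> f \<in> hom G H \<and> f \<one>\<^bsub>G\<^esub> = \<one>\<^bsub>H\<^esub>"

locale semi_biproduct = X: monoid X + A: monoid A + B: monoid B
  for X :: "('x, 'i) monoid_scheme"
    and A :: "('a, 'j) monoid_scheme"
    and B :: "('b, 'l) monoid_scheme" +
  fixes p :: "'a \<Rightarrow> 'b" and k :: "'x \<Rightarrow> 'a" and q :: "'a \<Rightarrow> 'x" and s :: "'b \<Rightarrow> 'a"
  assumes p_hom: "monoid_homomorphism A B p"
    and k_hom: "monoid_homomorphism X A k"
    and q_zero: "zero_preserving A X q"
    and s_zero: "zero_preserving B A s"
    and p_s: "b \<in> carrier B \<Longrightarrow> p (s b) = b"
    and q_k: "x \<in> carrier X \<Longrightarrow> q (k x) = x"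
    and kq_sp: "a \<in> carrier A \<Longrightarrow> k (q a) \<otimes>\<^bsub>A\<^esub> s (p a) = a"
    and p_k: "x \<in> carrier X \<Longrightarrow> p (k x) = \<one>\<^bsub>B\<^esub>"
    and q_s: "b \<in> carrier B \<Longrightarrow> q (s b) = \<one>\<^bsub>X\<^esub>"

text \<open>The operations \<open>b \<cdot> x\<close>, \<open>x\<close> to the power \<open>b\<close>, and \<open>b \<times> b'\<close>, in this order.\<close>

definition sb_act ::
    "('a, 'm) monoid_scheme \<Rightarrow> ('x \<Rightarrow> 'a) \<Rightarrow> ('a \<Rightarrow> 'x) \<Rightarrow> ('b \<Rightarrow> 'a) \<Rightarrow> 'b \<Rightarrow> 'x \<Rightarrow> 'x" where
  "sb_act A k q s b x = q (s b \<otimes>\<^bsub>A\<^esub> k x)"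

definition sb_exp ::
    "('a, 'm) monoid_scheme \<Rightarrow> ('x \<Rightarrow> 'a) \<Rightarrow> ('a \<Rightarrow> 'x) \<Rightarrow> ('b \<Rightarrow> 'a) \<Rightarrow> 'x \<Rightarrow> 'b \<Rightarrow> 'x" where
  "sb_exp A k q s x b = q (k x \<otimes>\<^bsub>A\<^esub> s b)"

definition sb_fac ::
    "('a, 'm) monoid_scheme \<Rightarrow> ('a \<Rightarrow> 'x) \<Rightarrow> ('b \<Rightarrow> 'a) \<Rightarrow> 'b \<Rightarrow> 'b \<Rightarrow> 'x" where
  "sb_fac A q s b b' = q (s b \<otimes>\<^bsub>A\<^esub> s b')"

definition sb_beta :: "('a \<Rightarrow> 'b) \<Rightarrow> ('a \<Rightarrow> 'x) \<Rightarrow> 'a \<Rightarrow> 'x \<times> 'b" where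
  "sb_beta p q a = (q a, p a)"

text \<open>Only the values on pairs \<open>(sb_exp A k q s x b, b)\<close> are relevant.\<close>

definition sb_alpha ::
    "('a, 'm) monoid_scheme \<Rightarrow> ('x \<Rightarrow> 'a) \<Rightarrow> ('b \<Rightarrow> 'a) \<Rightarrow> 'x \<times> 'b \<Rightarrow> 'a" where
  "sb_alpha A k s = (\<lambda>(y, b). k y \<otimes>\<^bsub>A\<^esub> s b)"

end

theory Submission
  imports Defs
begin

text \<open>
  Everything comes from applying the decomposition \<open>a = k (q a) + s (p a)\<close> to elements of \<open>A\<close>
  whose image under \<open>p\<close> is known. For \<open>k x + s b\<close>, which \<open>p\<close> maps to \<open>b\<close>, it shows that replacing
  \<open>x\<close> by \<open>x\<^sup>b\<close> does not change \<open>k x + s b\<close>; for \<open>s b + k x\<close> and \<open>s b + s b'\<close> it gives rules for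
  moving \<open>s\<close> to the right of \<open>k\<close> and for merging two values of \<open>s\<close>, and these bring
  \<open>a + a' = k (q a) + s (p a) + k (q a') + s (p a')\<close> to the form \<open>k u + s v\<close>.
\<close>

context semi_biproduct
begin

lemma p_closed [simp]: "a \<in> carrier A \<Longrightarrow> p a \<in> carrier B"
  and p_mult: "a \<in> carrier A \<Longrightarrow> a' \<in> carrier A \<Longrightarrow> p (a \<otimes>\<^bsub>A\<^esub> a') = p a \<otimes>\<^bsub>B\<^esub> p a'"
  using p_hom by (auto simp: monoid_homomorphism_def hom_def)

lemma k_closed [simp]: "x \<in> carrier X \<Longrightarrow> k x \<in> carrier A"
  and k_mult: "x \<in> carrier X \<Longrightarrow> y \<in> carrier X \<Longrightarrow> k (x \<otimes>\<^bsub>X\<^esub> y) = k x \<otimes>\<^bsub>A\<^esub> k y"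
  using k_hom by (auto simp: monoid_homomorphism_def hom_def)

lemma q_closed [simp]: "a \<in> carrier A \<Longrightarrow> q a \<in> carrier X"
  using q_zero by (auto simp: zero_preserving_def)

lemma s_closed [simp]: "b \<in> carrier B \<Longrightarrow> s b \<in> carrier A"
  using s_zero by (auto simp: zero_preserving_def)

lemma sb_act_closed [simp]:
  "b \<in> carrier B \<Longrightarrow> x \<in> carrier X \<Longrightarrow> sb_act A k q s b x \<in> carrier X"
  by (simp add: sb_act_def)

lemma sb_exp_closed [simp]:
  "x \<in> carrier X \<Longrightarrow> b \<in> carrier B \<Longrightarrow> sb_exp A k q s x b \<in> carrier X"
  by (simp add: sb_exp_def)

lemma sb_fac_closed [simp]:
  "b \<in> carrier B \<Longrightarrow> b' \<in> carrier B \<Longrightarrow> sb_fac A q s b b' \<in> carrier X"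
  by (simp add: sb_fac_def)

lemma p_k_s:
  assumes "x \<in> carrier X" "b \<in> carrier B"
  shows "p (k x \<otimes>\<^bsub>A\<^esub> s b) = b"
  using assms by (simp add: p_mult p_k p_s)

text \<open>By \<open>p_k_s\<close> the decomposition of \<open>k x + s b\<close> ends in
  \<open>s b\<close>, and the argument of \<open>k\<close> in it is \<open>x^b\<close> by
  definition.\<close>

lemma k_sb_exp:
  assumes "x \<in> carrier X" "b \<in> carrier B"
  shows "k (sb_exp A k q s x b) \<otimes>\<^bsub>A\<^esub> s b = k x \<otimes>\<^bsub>A\<^esub> s b"
  using kq_sp [of "k x \<otimes>\<^bsub>A\<^esub> s b"] assms by (simp add: p_k_s sb_exp_def)

text \<open>Exchange law: as \<open>p (s b + k x) = b\<close>, the decomposition of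
  \<open>s b + k x\<close> ends in \<open>s b\<close> again. The action is the price of moving
  \<open>s b\<close> to the right.\<close>

lemma s_k:
  assumes "b \<in> carrier B" "x \<in> carrier X"
  shows "s b \<otimes>\<^bsub>A\<^esub> k x = k (sb_act A k q s b x) \<otimes>\<^bsub>A\<^esub> s b"
  using kq_sp [of "s b \<otimes>\<^bsub>A\<^esub> k x"] assms by (simp add: p_mult p_k p_s sb_act_def)

text \<open>\<open>sb_fac\<close> plays the role of a factor set: it records how far
  \<open>s\<close> is from respecting the operations.\<close>

lemma s_s:
  assumes "b \<in> carrier B" "b' \<in> carrier B"
  shows "s b \<otimes>\<^bsub>A\<^esub> s b' = k (sb_fac A q s b b') \<otimes>\<^bsub>A\<^esub> s (b \<otimes>\<^bsub>B\<^esub> b')"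
  using kq_sp [of "s b \<otimes>\<^bsub>A\<^esub> s b'"] assms by (simp add: p_mult p_s sb_fac_def)

text \<open>Moving \<open>s b\<close> past \<open>k x'\<close> puts it next to \<open>s b'\<close>.
  Merging these two leaves values of the homomorphism \<open>k\<close>, which combine into one,
  followed by a single value of \<open>s\<close>.\<close>

lemma k_s_mult_k_s:
  assumes x: "x \<in> carrier X" and x': "x' \<in> carrier X"
    and b: "b \<in> carrier B" and b': "b' \<in> carrier B"
  shows "(k x \<otimes>\<^bsub>A\<^esub> s b) \<otimes>\<^bsub>A\<^esub> (k x' \<otimes>\<^bsub>A\<^esub> s b') =
    k (x \<otimes>\<^bsub>X\<^esub> sb_act A k q s b x' \<otimes>\<^bsub>X\<^esub> sb_fac A q s b b') \<otimes>\<^bsub>A\<^esub> s (b \<otimes>\<^bsub>B\<^esub> b')"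
proof -
  have "(k x \<otimes>\<^bsub>A\<^esub> s b) \<otimes>\<^bsub>A\<^esub> (k x' \<otimes>\<^bsub>A\<^esub> s b') = k x \<otimes>\<^bsub>A\<^esub> (s b \<otimes>\<^bsub>A\<^esub> k x') \<otimes>\<^bsub>A\<^esub> s b'"
    using assms by (simp add: A.m_assoc)
  also have "\<dots> = k x \<otimes>\<^bsub>A\<^esub> k (sb_act A k q s b x') \<otimes>\<^bsub>A\<^esub> (s b \<otimes>\<^bsub>A\<^esub> s b')"
    unfolding s_k [OF b x'] using assms by (simp add: A.m_assoc)
  also have "\<dots> = k (x \<otimes>\<^bsub>X\<^esub> sb_act A k q s b x' \<otimes>\<^bsub>X\<^esub> sb_fac A q s b b') \<otimes>\<^bsub>A\<^esub> s (b \<otimes>\<^bsub>B\<^esub> b')"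
    unfolding s_s [OF b b'] using assms by (simp add: A.m_assoc k_mult)
  finally show ?thesis .
qed

lemma mult_decomposition:
  assumes "a \<in> carrier A" "a' \<in> carrier A"
  shows "a \<otimes>\<^bsub>A\<^esub> a' =
    k (q a \<otimes>\<^bsub>X\<^esub> sb_act A k q s (p a) (q a') \<otimes>\<^bsub>X\<^esub> sb_fac A q s (p a) (p a'))
      \<otimes>\<^bsub>A\<^esub> s (p (a \<otimes>\<^bsub>A\<^esub> a'))"
  unfolding p_mult [OF assms]
  \<comment> \<open>With these arguments the two factors on the left are the decompositions of
    \<open>a\<close> and \<open>a'\<close>, so \<open>kq_sp\<close> folds them back.\<close>
  using k_s_mult_k_s [of "q a" "q a'" "p a" "p a'"] assms by (simp add: kq_sp)

lemma sb_exp_q_p: "a \<in> carrier A \<Longrightarrow> sb_exp A k q s (q a) (p a) = q a"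
  by (simp add: sb_exp_def kq_sp)

text \<open>This is the decomposition of \<open>a\<close>, read as a left inverse of
  \<open>sb_beta\<close>; injectivity follows from it.\<close>

lemma sb_alpha_beta: "a \<in> carrier A \<Longrightarrow> sb_alpha A k s (sb_beta p q a) = a"
  by (simp add: sb_alpha_def sb_beta_def kq_sp)

text \<open>Read from right to left, this gives \<open>k x + s b\<close> as a preimage of the pair
  \<open>(x^b, b)\<close>.\<close>

lemma sb_beta_k_s:
  assumes "x \<in> carrier X" "b \<in> carrier B"
  shows "sb_beta p q (k x \<otimes>\<^bsub>A\<^esub> s b) = (sb_exp A k q s x b, b)"
  using assms by (simp add: sb_beta_def p_k_s sb_exp_def)

lemma sb_alpha_exp:
  assumes "x \<in> carrier X" "b \<in> carrier B"
  shows "sb_alpha A k s (sb_exp A k q s x b, b) = k x \<otimes>\<^bsub>A\<^esub> s b"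
  using assms by (simp add: sb_alpha_def k_sb_exp)

lemma inj_on_sb_beta: "inj_on (sb_beta p q) (carrier A)"
  by (rule inj_on_inverseI [of _ "sb_alpha A k s"]) (rule sb_alpha_beta)

lemma sb_beta_image:
  "sb_beta p q ` carrier A =
    {(sb_exp A k q s x b, b) | x b. (x, b) \<in> carrier X \<times> carrier B}" (is "_ = ?S")
proof
  show "sb_beta p q ` carrier A \<subseteq> ?S"
  proof
    fix z assume "z \<in> sb_beta p q ` carrier A"
    then obtain a where a: "a \<in> carrier A" and "z = sb_beta p q a"
      by blast
    \<comment> \<open>The witness for \<open>x\<close> is \<open>q a\<close> itself, which the
      exponent \<open>p a\<close> leaves fixed.\<close>
    then have "z = (sb_exp A k q s (q a) (p a), p a)"
      by (simp add: sb_beta_def sb_exp_q_p)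
    moreover have "(q a, p a) \<in> carrier X \<times> carrier B"
      using a by simp
    ultimately show "z \<in> ?S"
      by blast
  qed
  show "?S \<subseteq> sb_beta p q ` carrier A"
    by (auto simp: sb_beta_k_s [symmetric])
qed

end

theorem theorem1:
  fixes X :: "('x, 'i) monoid_scheme"
    and A :: "('a, 'j) monoid_scheme"
    and B :: "('b, 'l) monoid_scheme"
    and p :: "'a \<Rightarrow> 'b" and k :: "'x \<Rightarrow> 'a" and q :: "'a \<Rightarrow> 'x" and s :: "'b \<Rightarrow> 'a"
  assumes "semi_biproduct X A B p k q s"
  shows
    "((\<forall>b\<in>carrier B. \<forall>x\<in>carrier X.
          sb_act A k q s b x \<in> carrier X \<and> sb_exp A k q s x b \<in> carrier X) \<and>
      (\<forall>b\<in>carrier B. \<forall>b'\<in>carrier B. sb_fac A q s b b' \<in> carrier X)) \<and>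
     (\<forall>a\<in>carrier A. \<forall>a'\<in>carrier A.
        a \<otimes>\<^bsub>A\<^esub> a' =
          k (q a \<otimes>\<^bsub>X\<^esub> sb_act A k q s (p a) (q a') \<otimes>\<^bsub>X\<^esub> sb_fac A q s (p a) (p a'))
            \<otimes>\<^bsub>A\<^esub> s (p (a \<otimes>\<^bsub>A\<^esub> a')) \<and>
        (let u = q a \<otimes>\<^bsub>X\<^esub> sb_act A k q s (p a) (q a') \<otimes>\<^bsub>X\<^esub> sb_fac A q s (p a) (p a');
             v = p (a \<otimes>\<^bsub>A\<^esub> a')
         in u \<in> carrier X \<and> v \<in> carrier B \<and>
            a \<otimes>\<^bsub>A\<^esub> a' = k (sb_exp A k q s u v) \<otimes>\<^bsub>A\<^esub> s v)) \<and>
     (sb_beta p q \<in> carrier A \<rightarrow> carrier X \<times> carrier B \<and>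
      inj_on (sb_beta p q) (carrier A) \<and>
      (\<forall>y\<in>carrier X. \<forall>b\<in>carrier B.
        (y, b) \<in> sb_beta p q ` carrier A \<longleftrightarrow> (\<exists>x\<in>carrier X. y = sb_exp A k q s x b)) \<and>
      (let S = {(sb_exp A k q s x b, b) | x b. (x, b) \<in> carrier X \<times> carrier B}
       in bij_betw (sb_beta p q) (carrier A) S \<and>
          sb_alpha A k s \<in> S \<rightarrow> carrier A \<and>
          (\<forall>a\<in>carrier A. sb_alpha A k s (sb_beta p q a) = a) \<and>
          (\<forall>z\<in>S. sb_beta p q (sb_alpha A k s z) = z)) \<and>
      (\<forall>x\<in>carrier X. \<forall>b\<in>carrier B.
        sb_alpha A k s (sb_exp A k q s x b, b) = k (sb_exp A k q s x b) \<otimes>\<^bsub>A\<^esub> s b \<and>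
        k (sb_exp A k q s x b) \<otimes>\<^bsub>A\<^esub> s b = k x \<otimes>\<^bsub>A\<^esub> s b)) \<and>
     (\<forall>a\<in>carrier A. q a = sb_exp A k q s (q a) (p a))"
proof -
  interpret semi_biproduct X A B p k q s
    by fact
  have decomposition: "a \<otimes>\<^bsub>A\<^esub> a' = k (sb_exp A k q s u v) \<otimes>\<^bsub>A\<^esub> s v"
    if "a \<in> carrier A" "a' \<in> carrier A"
      and "u = q a \<otimes>\<^bsub>X\<^esub> sb_act A k q s (p a) (q a') \<otimes>\<^bsub>X\<^esub> sb_fac A q s (p a) (p a')"
      and "v = p (a \<otimes>\<^bsub>A\<^esub> a')" for a a' u v
    \<comment> \<open>\<open>k_sb_exp\<close> removes the exponent \<open>v\<close> from
      \<open>u\<close>; what remains is the first decomposition of the sum.\<close>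
    using that by (simp add: k_sb_exp mult_decomposition [symmetric])
  have image: "(y, b) \<in> sb_beta p q ` carrier A \<longleftrightarrow> (\<exists>x\<in>carrier X. y = sb_exp A k q s x b)"
    if "b \<in> carrier B" for y b
    using that by (auto simp: sb_beta_image)
  have beta: "sb_beta p q \<in> carrier A \<rightarrow> carrier X \<times> carrier B"
    by (auto simp: sb_beta_def)
  show ?thesis
    unfolding Let_def
    by (intro conjI ballI mult_decomposition decomposition refl beta inj_on_sb_beta image
        bij_betw_imageI sb_beta_image sb_alpha_beta sb_exp_q_p [symmetric] k_sb_exp)
      \<comment> \<open>Besides membership conditions, what is left concerns \<open>sb_alpha\<close>
        at pairs \<open>(x^b, b)\<close>: its value there is \<open>k x + s b\<close>, which
        \<open>sb_beta\<close> sends back to the pair.\<close>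
      (auto simp: sb_alpha_exp sb_beta_k_s k_sb_exp)
qed

end
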